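(* Let $n\ge 1$ and $1\le k\le n$ be integers, and define $t_k(A)=\min(|A|,k)$ for $A\subseteq[n]=\{1,\dots,n\}$. Then $t_k$ is entropic up to a constant factor, in the following sense: there exist a finite field size $q\ge n$ (that is, a prime power $q\ge n$) and jointly distributed random variables $X_1,\dots,X_n$ such that for all $A\subseteq[n]$, $$H(X_A)=\min(|A|,k)\cdot\log q.$$
   Context: $X_A=(X_i)_{i\in A}$, and $H$ denotes (joint) Shannon entropy of discrete random variables, computed with the same logarithm base as $\log q$, with $H(X_\emptyset)=0$. *)

theory Defs
  imports "HOL-Probability.Probability" "HOL-Number_Theory.Prime_Powers"
begin

(* The marginal (X_i)_{i in A} is represented by the extensional function restricted to A, so for
   A = {} it is a constant random variable, of entropy 0. The reference measure of the library
   entropy is the counting measure on the range, which makes it Shannon entropy in base b,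
   provided that M is a probability space, b > 1 and the X_i are simple functions. *)
definition joint_entropy ::
  "'w measure \<Rightarrow> real \<Rightarrow> ('i \<Rightarrow> 'w \<Rightarrow> 'v) \<Rightarrow> 'i set \<Rightarrow> real" where
  "joint_entropy M b X A =
     (let XA = (\<lambda>\<omega>. \<lambda>i\<in>A. X i \<omega>)
      in prob_space.entropy M b (count_space (XA ` space M)) XA)"

definition trunc_card :: "nat \<Rightarrow> 'i set \<Rightarrow> nat" where
  "trunc_card k A = min (card A) k"

lemma joint_entropy_empty:
  assumes "prob_space M" and "1 < b"
  shows "joint_entropy M b X {} = 0"
proof -
  interpret prob_space M by fact
  interpret information_space M b by unfold_locales (fact assms(2))
  let ?c = "\<lambda>i. undefined"
  have s: "(\<lambda>\<omega>. \<lambda>i\<in>{}. X i \<omega>) = (\<lambda>\<omega>. ?c)" by (simp add: restrict_def)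
  have "simple_distributed M (\<lambda>\<omega>. ?c) (\<lambda>x. measure M ((\<lambda>\<omega>. ?c) -` {x} \<inter> space M))"
    by (rule simple_distributedI) (auto simp: vimage_def Int_def)
  from entropy_simple_distributed[OF this] not_empty
  show ?thesis
    unfolding joint_entropy_def Let_def s by (simp add: image_constant_conv prob_space)
qed

end

theory Submission
  imports Defs
begin

(* Reed-Solomon code: over the field with q elements, q a prime with q >= n, choose the k
   coefficients of a polynomial of degree < k uniformly and let X_i be its value at i. A polynomial
   of degree < k is determined by its values at any k points, so any k of the X_i determine the
   polynomial, and by counting they are uniform on all k-tuples. Hence the map X_A has fibres of
   constant size q^(k - |A|), with truncated subtraction. *)

text \<open>Induction on \<open>A\<close>, splitting off one root \<open>a\<close> by synthetic
  division: modulo \<open>p\<close>, \<open>f\<close> is \<open>(x - a) * g\<close>, and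
  \<open>g\<close> inherits the remaining roots. Divisibility by the constant \<open>[:p:]\<close>
  says that all coefficients vanish modulo \<open>p\<close>, so integer polynomials stand in for
  polynomials over the field with \<open>p\<close> elements.\<close>

lemma dvd_poly_of_many_roots_mod_prime:
  fixes f :: "int poly"
  assumes "finite A" and p: "prime p" and "inj_on (\<lambda>x. x mod p) A"
    and "\<And>x. x \<in> A \<Longrightarrow> p dvd poly f x" and "degree f < card A"
  shows "[:p:] dvd f"
  using assms(1,3-)
proof (induction A arbitrary: f rule: finite_induct)
  case empty
  then show ?case by simp
next
  case (insert a A)
  define g where "g = synthetic_div f a"
  have f: "f = [:-a, 1:] * g + [:poly f a:]"
    unfolding g_def by (rule synthetic_div_correct'[symmetric])
  have fa: "p dvd poly f a" using insert.prems by simp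
  have "[:p:] dvd g"
  \<comment> \<open>For constant \<open>f\<close> the quotient has degree 0 too, so the degree does
    not drop and the induction hypothesis could fail to apply when \<open>A\<close> is
    empty.\<close>
  proof (cases "degree f = 0")
    case True
    then have "g = 0" by (simp add: g_def synthetic_div_eq_0_iff)
    then show ?thesis by simp
  next
    case False
    have "degree g < card A"
      using insert.prems(3) insert.hyps False by (simp add: g_def degree_synthetic_div)
    moreover have "p dvd poly g x" if "x \<in> A" for x
    proof -
      have "poly f x = (x - a) * poly g x + poly f a"
        using arg_cong[OF f, of "\<lambda>h. poly h x"] by (simp only: poly_add poly_mult) (simp add: algebra_simps)
      then have "p dvd (x - a) * poly g x"
        using insert.prems(2)[of x] that fa by (simp add: dvd_add_left_iff)
      \<comment> \<open>Distinct residues make \<open>x - a\<close> a unit modulo \<open>p\<close>;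
        primality then moves the divisibility to \<open>poly g x\<close>.\<close>
      moreover have "\<not> p dvd x - a"
        using insert.prems(1) insert.hyps that by (auto simp: inj_on_def mod_eq_dvd_iff)
      ultimately show ?thesis using p by (simp add: prime_dvd_mult_iff)
    qed
    moreover have "inj_on (\<lambda>x. x mod p) A" using insert.prems(1) by simp
    ultimately show ?thesis by (intro insert.IH)
  qed
  moreover have "[:p:] dvd [:poly f a:]" using fa
    by (simp add: const_poly_dvd_iff coeff_pCons split: nat.split)
  ultimately have "[:p:] dvd [:-a, 1:] * g + [:poly f a:]" by (intro dvd_add dvd_mult)
  with f show ?case by (rule ssubst)
qed

text \<open>Field elements are encoded as their representatives below \<open>p\<close>, and
  \<open>c\<close> lists the coefficients of the message polynomial.\<close>

definition rs_symbol :: "nat \<Rightarrow> nat \<Rightarrow> (nat \<Rightarrow> nat) \<Rightarrow> nat \<Rightarrow> nat" where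
  "rs_symbol p k c i = (\<Sum>j<k. c j * i ^ j) mod p"

lemma rs_symbol_less: "p > 0 \<Longrightarrow> rs_symbol p k c i < p"
  by (simp add: rs_symbol_def)

text \<open>The difference of two message polynomials with equal symbols on \<open>B\<close> has
  degree below \<open>k\<close> and \<open>k\<close> roots modulo \<open>p\<close>, so it vanishes
  modulo \<open>p\<close>.\<close>

lemma inj_on_rs_symbol:
  assumes p: "prime p" and B: "finite B" "card B = k" "inj_on (\<lambda>i. i mod p) B"
  shows "inj_on (\<lambda>c. \<lambda>i\<in>B. rs_symbol p k c i) ({..<k} \<rightarrow>\<^sub>E {..<p})"
proof (rule inj_onI)
  fix c d assume cd: "c \<in> {..<k} \<rightarrow>\<^sub>E {..<p}" "d \<in> {..<k} \<rightarrow>\<^sub>E {..<p}"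
    and eq: "(\<lambda>i\<in>B. rs_symbol p k c i) = (\<lambda>i\<in>B. rs_symbol p k d i)"
  show "c = d"
  \<comment> \<open>The zero polynomial has degree 0, so the bound \<open>degree f < k\<close> fails
    for \<open>k = 0\<close>.\<close>
  proof (cases "k = 0")
    case True
    with cd show ?thesis by simp
  next
    case False
    \<comment> \<open>The coefficients are subtracted as integers, since subtraction on
      \<open>nat\<close> truncates.\<close>
    define f where "f = (\<Sum>j<k. monom (int (c j) - int (d j)) j)"
    have "[:int p:] dvd f"
    proof (rule dvd_poly_of_many_roots_mod_prime[of "int ` B"])
      show "inj_on (\<lambda>x. x mod int p) (int ` B)"
        using B(3) by (auto simp: inj_on_def simp flip: zmod_int)
      have "degree f \<le> k - 1"
        unfolding f_def by (intro degree_sum_le) (auto intro: order.trans[OF degree_monom_le])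
      then show "degree f < card (int ` B)"
        using False B by (simp add: card_image)
      show "int p dvd poly f x" if "x \<in> int ` B" for x
      proof -
        obtain i where i: "x = int i" "i \<in> B" using \<open>x \<in> int ` B\<close> by auto
        have "rs_symbol p k c i = rs_symbol p k d i"
          using fun_cong[OF eq, of i] i by simp
        then have "int (\<Sum>j<k. c j * i ^ j) mod int p = int (\<Sum>j<k. d j * i ^ j) mod int p"
          unfolding rs_symbol_def by (metis zmod_int)
        then have "int p dvd int (\<Sum>j<k. c j * i ^ j) - int (\<Sum>j<k. d j * i ^ j)"
          by (simp only: mod_eq_dvd_iff)
        also have "\<dots> = poly f x"
          by (simp add: f_def i poly_sum poly_monom sum_subtractf algebra_simps)
        finally show ?thesis .
      qed
    qed (use p B in auto)
    then have dvd: "int p dvd coeff f j" for j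
      using const_poly_dvd_iff by blast
    have "c j = d j" if "j < k" for j
    proof -
      have "coeff f j = int (c j) - int (d j)"
        using that by (simp add: f_def coeff_sum coeff_monom if_distrib sum.delta cong: if_cong)
      with dvd[of j] have "int (c j) mod int p = int (d j) mod int p"
        by (simp add: mod_eq_dvd_iff)
      \<comment> \<open>Both coefficients are reduced representatives, so congruence becomes
        equality.\<close>
      moreover have "c j < p" "d j < p" using cd that by auto
      ultimately show ?thesis by simp
    qed
    with cd show ?thesis by (intro PiE_ext) auto
  qed
qed

text \<open>An injection between finite sets of the same size \<open>p ^ k\<close> is onto.\<close>

lemma bij_betw_rs_symbol:
  assumes p: "prime p" and B: "finite B" "card B = k" "inj_on (\<lambda>i. i mod p) B"
  shows "bij_betw (\<lambda>c. \<lambda>i\<in>B. rs_symbol p k c i) ({..<k} \<rightarrow>\<^sub>E {..<p}) (B \<rightarrow>\<^sub>E {..<p})"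
    (is "bij_betw ?f ?C ?V")
proof -
  have inj: "inj_on ?f ?C" by (rule inj_on_rs_symbol) fact+
  have "card (?f ` ?C) = card ?V"
    using B by (simp add: card_image[OF inj] card_funcsetE)
  moreover have "?f ` ?C \<subseteq> ?V"
    using rs_symbol_less prime_gt_0_nat[OF p] by auto
  moreover have "finite ?V" using B by (intro finite_PiE) auto
  ultimately have "?f ` ?C = ?V" by (simp add: card_subset_eq)
  with inj show ?thesis by (simp add: bij_betw_def)
qed

text \<open>Coordinates in \<open>A\<close> are forced to agree with \<open>v\<close>; those in
  \<open>B - A\<close> range freely over \<open>T\<close>.\<close>

lemma card_PiE_restrict_eq:
  assumes "finite B" and "A \<subseteq> B" and "v \<in> A \<rightarrow>\<^sub>E T"
  shows "card {w \<in> B \<rightarrow>\<^sub>E T. restrict w A = v} = card T ^ (card B - card A)"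
proof -
  have "{w \<in> B \<rightarrow>\<^sub>E T. restrict w A = v} = (\<Pi>\<^sub>E i\<in>B. if i \<in> A then {v i} else T)" (is "?L = ?R")
  proof (intro set_eqI iffI)
    fix w assume w: "w \<in> ?R"
    then have "w i \<in> T" if "i \<in> B" for i
      using PiE_mem[OF w that] assms(3) by (auto split: if_splits)
    moreover have "w i = v i" if "i \<in> A" for i
      using PiE_mem[OF w, of i] that assms(2) by auto
    then have "restrict w A = v"
      by (intro ext) (simp add: restrict_def PiE_arb[OF assms(3)])
    ultimately show "w \<in> ?L" using w by (auto simp: PiE_iff)
  qed (auto simp: PiE_iff)
  also have "card \<dots> = (\<Prod>i\<in>B. if i \<in> A then 1 else card T)"
    using assms(1) by (simp add: card_PiE if_distrib cong: if_cong)
  also have "\<dots> = card T ^ card (B - A)"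
    using assms(1) by (subst prod.If_cases) (simp_all add: Diff_eq)
  also have "card (B - A) = card B - card A"
    using assms by (simp add: card_Diff_subset finite_subset)
  finally show ?thesis .
qed

text \<open>If \<open>A\<close> has at most \<open>k\<close> points, enlarge it to a
  \<open>k\<close>-set \<open>B\<close> inside \<open>S\<close>: the bijection on \<open>B\<close>
  turns the fibre into the set of extensions of a fixed word from \<open>A\<close> to
  \<open>B\<close>. If \<open>A\<close> is larger, a \<open>k\<close>-subset already determines
  \<open>c\<close>, and the exponent truncates to 0.\<close>

lemma card_rs_symbol_fibre:
  assumes p: "prime p" and S: "finite S" "inj_on (\<lambda>i. i mod p) S" "k \<le> card S"
    and A: "A \<subseteq> S" and c0: "c0 \<in> {..<k} \<rightarrow>\<^sub>E {..<p}"
  shows "card {c \<in> {..<k} \<rightarrow>\<^sub>E {..<p}. (\<lambda>i\<in>A. rs_symbol p k c i) = (\<lambda>i\<in>A. rs_symbol p k c0 i)}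
    = p ^ (k - card A)" (is "card {c \<in> ?C. ?f A c = ?f A c0} = _")
proof (cases "card A \<le> k")
  case True
  then obtain B where B: "A \<subseteq> B" "B \<subseteq> S" "card B = k"
    using exists_subset_between[of A k S] S A by auto
  have finB: "finite B" using B S finite_subset by blast
  have bij: "bij_betw (?f B) ?C (B \<rightarrow>\<^sub>E {..<p})"
    using p B S finB by (intro bij_betw_rs_symbol) (auto intro: inj_on_subset)
  have AB: "restrict (?f B c) A = ?f A c" for c
    using B by (intro ext) (auto simp: restrict_def)
  have "bij_betw (?f B) {c \<in> ?C. ?f A c = ?f A c0}
      {w \<in> B \<rightarrow>\<^sub>E {..<p}. restrict w A = ?f A c0}"
    using bij by (rule bij_betw_Collect) (simp only: AB)
  then have "card {c \<in> ?C. ?f A c = ?f A c0} =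
      card {w \<in> B \<rightarrow>\<^sub>E {..<p}. restrict w A = ?f A c0}"
    by (rule bij_betw_same_card)
  also have "\<dots> = p ^ (k - card A)"
    using finB B rs_symbol_less prime_gt_0_nat[OF p] by (subst card_PiE_restrict_eq) auto
  finally show ?thesis .
next
  case False
  then obtain B where B: "B \<subseteq> A" "card B = k" "finite B"
    using obtain_subset_with_card_n[of k A] by auto
  have inj: "inj_on (?f B) ?C"
    using p B A S by (intro inj_on_rs_symbol) (auto intro: inj_on_subset)
  have "c = c0" if "c \<in> ?C" "?f A c = ?f A c0" for c
  proof (rule inj_onD[OF inj _ that(1) c0])
    have "rs_symbol p k c i = rs_symbol p k c0 i" if "i \<in> B" for i
      using fun_cong[OF \<open>?f A c = ?f A c0\<close>, of i] B that by (auto split: if_splits)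
    then show "?f B c = ?f B c0" by (intro restrict_ext)
  qed
  with c0 have "{c \<in> ?C. ?f A c = ?f A c0} = {c0}" by blast
  then show ?thesis using False by (simp only:) simp
qed

lemma simple_function_uniform_count_measure:
  "finite \<Omega> \<Longrightarrow> simple_function (uniform_count_measure \<Omega>) Y"
  by (simp add: simple_function_def space_uniform_count_measure sets_uniform_count_measure)

text \<open>Each value of \<open>Y\<close> has probability \<open>m / card \<Omega>\<close>, so
  \<open>Y\<close> is uniform on its range, which has \<open>card \<Omega> / m\<close>
  elements.\<close>

lemma entropy_uniform_fibres:
  assumes \<Omega>: "finite \<Omega>" "\<Omega> \<noteq> {}" and b: "1 < b"
    and fib: "\<And>x. x \<in> \<Omega> \<Longrightarrow> card {y \<in> \<Omega>. Y y = Y x} = m"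
  shows "prob_space.entropy (uniform_count_measure \<Omega>) b (count_space (Y ` \<Omega>)) Y
    = log b (real (card \<Omega>) / real m)"
proof -
  define M where "M = uniform_count_measure \<Omega>"
  have sp: "space M = \<Omega>" by (simp add: M_def space_uniform_count_measure)
  interpret prob_space M
    unfolding M_def using \<Omega> by (rule prob_space_uniform_count_measure)
  interpret information_space M b by unfold_locales (fact b)
  let ?r = "real m / real (card \<Omega>)"
  have pr: "prob (Y -` {v} \<inter> space M) = ?r" if v: "v \<in> Y ` \<Omega>" for v
  proof -
    obtain x where x: "x \<in> \<Omega>" "v = Y x" using v by blast
    have "Y -` {v} \<inter> \<Omega> = {y \<in> \<Omega>. Y y = Y x}" using x by auto
    then show ?thesis
      using \<Omega> fib[OF x(1)] unfolding M_def
      by (simp add: measure_uniform_count_measure space_uniform_count_measure)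
  qed
  have "simple_distributed M Y (\<lambda>v. ?r)"
    using \<Omega> pr by (intro simple_distributedI)
      (auto simp: sp M_def simple_function_uniform_count_measure space_uniform_count_measure)
  from entropy_simple_distributed[OF this]
  have "entropy b (count_space (Y ` \<Omega>)) Y = - (real (card (Y ` \<Omega>)) * ?r) * log b ?r"
    by (simp add: sp)
  \<comment> \<open>Partition \<open>\<Omega>\<close> into the fibres of \<open>Y\<close>, each of
    size \<open>m\<close>.\<close>
  also have "real (card (Y ` \<Omega>)) * ?r = 1"
  proof -
    have "card \<Omega> = (\<Sum>v\<in>Y ` \<Omega>. card {y \<in> \<Omega>. Y y = v})"
      using sum.image_gen[OF \<Omega>(1), of "\<lambda>_. 1::nat" Y] by simp
    also have "\<dots> = card (Y ` \<Omega>) * m" using fib by (subst sum.cong[OF refl, of _ _ "\<lambda>_. m"]) auto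
    finally have "card \<Omega> = card (Y ` \<Omega>) * m" .
    moreover have "card \<Omega> \<noteq> 0" using \<Omega> by simp
    ultimately show ?thesis by (simp flip: of_nat_mult)
  qed
  also have "- 1 * log b ?r = log b (real (card \<Omega>) / real m)"
    by (simp only: log_inverse[symmetric] inverse_divide mult_minus_left mult_1)
  finally show ?thesis by (simp add: M_def)
qed

theorem theorem3:
  fixes n k :: nat and b :: real
  assumes "1 \<le> n" and "1 \<le> k" and "k \<le> n" and "1 < b"
  shows "\<exists>(q::nat) (M::nat measure) (X::nat \<Rightarrow> nat \<Rightarrow> nat).
    primepow q \<and> n \<le> q \<and> prob_space M \<and>
    (\<forall>i\<in>{1..n}. simple_function M (X i)) \<and>
    (\<forall>A\<subseteq>{1..n}. joint_entropy M b X A = real (trunc_card k A) * log b (real q))"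
proof -
  \<comment> \<open>The strict bound makes each point of \<open>{1..n}\<close> its own residue, so
    the evaluation points are distinct modulo \<open>p\<close>.\<close>
  obtain p where p: "prime p" "n < p" using bigger_prime by blast
  let ?C = "{..<k} \<rightarrow>\<^sub>E {..<p}" and ?\<Omega> = "{0..<p ^ k}"
  have cardC: "card ?C = p ^ k" by (simp add: card_funcsetE)
  have "finite ?C" by (intro finite_PiE) auto
  \<comment> \<open>The measure is to live on \<open>nat\<close>, so the coefficient vectors are
    numbered by \<open>e\<close>; a bijection preserves fibre sizes.\<close>
  from ex_bij_betw_nat_finite[OF this] obtain e where e: "bij_betw e ?\<Omega> ?C"
    unfolding cardC by blast
  define M where "M = uniform_count_measure ?\<Omega>"
  define X where "X = (\<lambda>i \<omega>. rs_symbol p k (e \<omega>) i)"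
  have p0: "p > 0" using p by simp
  then have ne: "?\<Omega> \<noteq> {}" by simp
  have "joint_entropy M b X A = real (trunc_card k A) * log b (real p)" if A: "A \<subseteq> {1..n}" for A
  proof -
    let ?Y = "\<lambda>\<omega>. \<lambda>i\<in>A. X i \<omega>" and ?f = "\<lambda>c. \<lambda>i\<in>A. rs_symbol p k c i"
    have "card {y \<in> ?\<Omega>. ?Y y = ?Y x} = p ^ (k - card A)" if x: "x \<in> ?\<Omega>" for x
    proof -
      have "bij_betw e {y \<in> ?\<Omega>. ?Y y = ?Y x} {c \<in> ?C. ?f c = ?f (e x)}"
        using e by (rule bij_betw_Collect) (simp add: X_def)
      then have "card {y \<in> ?\<Omega>. ?Y y = ?Y x} = card {c \<in> ?C. ?f c = ?f (e x)}"
        by (rule bij_betw_same_card)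
      also have "\<dots> = p ^ (k - card A)"
      proof (rule card_rs_symbol_fibre[of p "{1..n}"])
        show "inj_on (\<lambda>i. i mod p) {1..n}" using p by (auto simp: inj_on_def)
        show "e x \<in> ?C" using e x by (rule bij_betwE[rule_format])
      qed (use p A assms in auto)
      finally show ?thesis .
    qed
    then have "joint_entropy M b X A = log b (real (card ?\<Omega>) / real (p ^ (k - card A)))"
      unfolding joint_entropy_def Let_def M_def space_uniform_count_measure
      using assms(4) ne by (intro entropy_uniform_fibres) auto
    \<comment> \<open>The truncated exponent yields both cases of the minimum: the quotient is
      \<open>p ^ card A\<close> up to size \<open>k\<close>, and \<open>p ^ k\<close>
      beyond.\<close>
    also have "real (card ?\<Omega>) / real (p ^ (k - card A)) = real p ^ trunc_card k A"
      using p0 by (simp add: trunc_card_def min_def flip: power_diff)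
    also have "log b \<dots> = real (trunc_card k A) * log b (real p)"
      using p0 by (intro log_nat_power) simp
    finally show ?thesis .
  qed
  moreover have "prob_space M"
    unfolding M_def using ne by (intro prob_space_uniform_count_measure) auto
  moreover have "\<forall>i\<in>{1..n}. simple_function M (X i)"
    by (simp add: M_def simple_function_uniform_count_measure)
  ultimately show ?thesis
    using p by (intro exI[of _ p] exI[of _ M] exI[of _ X]) (auto intro: primepow_prime)
qed

end
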